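(* Let $m\ge3$, $n\ge2$, and let $\mathcal{A}$ be a real symmetric $m$-th order $n$-dimensional tensor. The following are equivalent: (i) $\mathcal{A}$ is not copositive; (ii) there exists $\varepsilon>0$ such that for every simplicial partition $\widetilde S=\{S_1,\dots,S_r\}$ of $S_0=\{\mathbf{x}\in\mathbb{R}^n_+:\|\mathbf{x}\|_1=1\}$ with $d(\widetilde S)<\varepsilon$, where each $S_k$ has vertices $\mathbf{u}^k_1,\dots,\mathbf{u}^k_n$, there exist $k\in[r]$ and $i\in[n]$ with $\mathcal{A}(\mathbf{u}^k_i)^m<0$.
   Context: A symmetric tensor $\mathcal{A}=(a_{i_1\cdots i_m})$ has entries invariant under permutation of indices; $\mathcal{A}\mathbf{x}^m=\sum_{i_1,\dots,i_m}a_{i_1\cdots i_m}x_{i_1}\cdots x_{i_m}$. $\mathcal{A}$ is copositive if $\mathcal{A}\mathbf{x}^m\ge0$ for all $\mathbf{x}\in\mathbb{R}^n_+$. $\{S_1,\dots,S_r\}$ (simplices in $\mathbb{R}^n$, each with $n$ vertices) is a simplicial partition of $S_0$ if $S_0=\bigcup_k S_k$ and $\mathrm{int}\,S_i\cap\mathrm{int}\,S_j=\emptyset$ for $i\ne j$. Its mesh is $d(\widetilde S)=\max_{k\in[r]}\max_{i,j\in[n]}\|\mathbf{u}^k_i-\mathbf{u}^k_j\|_2$. *)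

theory Defs
  imports "HOL-Analysis.Analysis" "HOL-Combinatorics.Permutations"
begin

text \<open>
  The index set \<open>[n]\<close> is a finite type \<open>'n\<close>, so \<open>n = CARD('n)\<close>. A tensor of order \<open>m\<close> assigns
  an entry to every multi-index \<open>(i\<^sub>1, \<dots>, i\<^sub>m)\<close>, given as a list of length \<open>m\<close>; values at lists
  of other lengths are never looked at.
\<close>

definition symmetric_tensor :: "nat \<Rightarrow> ('n list \<Rightarrow> real) \<Rightarrow> bool" where
  "symmetric_tensor m A \<longleftrightarrow>
     (\<forall>is p. length is = m \<and> p permutes {..<m} \<longrightarrow> A (permute_list p is) = A is)"

definition tensor_form :: "nat \<Rightarrow> ('n::finite list \<Rightarrow> real) \<Rightarrow> real^'n \<Rightarrow> real" where
  "tensor_form m A x = (\<Sum>is | length is = m. A is * (\<Prod>k<m. x $ (is ! k)))"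

definition nonneg_orthant :: "(real^'n) set" where
  "nonneg_orthant = {x. \<forall>i. 0 \<le> x $ i}"

definition copositive :: "nat \<Rightarrow> ('n::finite list \<Rightarrow> real) \<Rightarrow> bool" where
  "copositive m A \<longleftrightarrow> (\<forall>x\<in>nonneg_orthant. 0 \<le> tensor_form m A x)"

definition l1_norm :: "real^'n \<Rightarrow> real" where
  "l1_norm x = (\<Sum>i\<in>UNIV. \<bar>x $ i\<bar>)"

definition standard_simplex :: "(real^'n) set" where
  "standard_simplex = {x \<in> nonneg_orthant. l1_norm x = 1}"

text \<open>
  \<open>u k i\<close> is the \<open>i\<close>-th vertex of the \<open>k\<close>-th simplex, \<open>k \<in> {1..r}\<close>. A simplex has \<open>n\<close> distinct,
  affinely independent vertices, hence dimension \<open>n - 1\<close> and empty topological interior in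
  \<open>\<real>\<^sup>n\<close>; ``int'' in the definition of a simplicial partition is therefore the relative interior.
\<close>

definition vertices_of_simplex :: "('n \<Rightarrow> real^'n) \<Rightarrow> (real^'n) set \<Rightarrow> bool" where
  "vertices_of_simplex v S \<longleftrightarrow>
     inj v \<and> \<not> affine_dependent (range v) \<and> S = convex hull (range v)"

definition simplicial_partition ::
    "nat \<Rightarrow> (nat \<Rightarrow> (real^'n) set) \<Rightarrow> (nat \<Rightarrow> 'n \<Rightarrow> real^'n) \<Rightarrow> (real^'n) set \<Rightarrow> bool" where
  "simplicial_partition r S u S0 \<longleftrightarrow>
     (\<forall>k\<in>{1..r}. vertices_of_simplex (u k) (S k)) \<and>
     S0 = (\<Union>k\<in>{1..r}. S k) \<and>
     (\<forall>i\<in>{1..r}. \<forall>j\<in>{1..r}. i \<noteq> j \<longrightarrow> rel_interior (S i) \<inter> rel_interior (S j) = {})"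

text \<open>
  \<open>norm\<close> on \<open>real^'n\<close> is the Euclidean norm. The maximum is meaningful for \<open>r \<ge> 1\<close>, which holds
  for every partition of a nonempty set.
\<close>

definition mesh :: "nat \<Rightarrow> (nat \<Rightarrow> 'n::finite \<Rightarrow> real^'n) \<Rightarrow> real" where
  "mesh r u = (MAX k\<in>{1..r}. MAX (i, j)\<in>UNIV. norm (u k i - u k j))"

end

theory Submission
  imports Defs
begin

text \<open>
  If \<open>\<A>\<close> takes a negative value on the orthant then, by homogeneity and continuity, it is negative
  on a ball around some point \<open>x\<close> of the simplex; the vertices of the cell containing \<open>x\<close> lie in that
  ball once the mesh is below its radius. Conversely, a single partition of mesh below \<open>\<epsilon>\<close> already
  provides a point at which the form is negative; such a partition exists because every polytope has
  arbitrarily fine triangulations into simplices of full dimension.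
\<close>

lemma standard_simplex_iff:
  "x \<in> standard_simplex \<longleftrightarrow> (\<forall>i. 0 \<le> x $ i) \<and> (\<Sum>i\<in>UNIV. x $ i) = 1"
  by (auto simp: standard_simplex_def nonneg_orthant_def l1_norm_def)

lemma convex_standard_simplex: "convex standard_simplex"
  unfolding convex_def
  by (auto simp: standard_simplex_iff sum.distrib sum_distrib_left [symmetric])

text \<open>The coordinates of a point of the simplex are its barycentric coordinates with respect
  to the unit vectors. This form of the set gives access to the results on polytopes and affine
  dimension.\<close>

lemma standard_simplex_eq_convex_hull_Basis:
  "(standard_simplex :: (real^'n) set) = convex hull Basis"
proof
  show "convex hull Basis \<subseteq> (standard_simplex :: (real^'n) set)"
  proof (intro hull_minimal convex_standard_simplex)
    show "Basis \<subseteq> (standard_simplex :: (real^'n) set)"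
      by (auto simp: Basis_vec_def standard_simplex_iff axis_def)
  qed
  show "(standard_simplex :: (real^'n) set) \<subseteq> convex hull Basis"
  proof
    fix x :: "real^'n"
    assume x: "x \<in> standard_simplex"
    have "(\<Sum>i\<in>UNIV. (x $ i) *\<^sub>R axis i (1::real)) \<in> convex hull Basis"
      using x by (intro convex_sum) (auto simp: standard_simplex_iff axis_in_Basis_iff intro!: hull_inc)
    also have "(\<Sum>i\<in>UNIV. (x $ i) *\<^sub>R axis i (1::real)) = x"
      using basis_expansion [of x] by (simp add: scalar_mult_eq_scaleR)
    finally show "x \<in> convex hull Basis" .
  qed
qed

lemma aff_dim_standard_simplex:
  "aff_dim (standard_simplex :: (real^'n) set) = int CARD('n) - 1"
proof -
  have "\<not> affine_dependent (Basis :: (real^'n) set)"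
    using affine_dependent_imp_dependent independent_Basis by blast
  then show ?thesis
    using aff_dim_affine_independent [of "Basis :: (real^'n) set"]
    by (simp add: standard_simplex_eq_convex_hull_Basis aff_dim_convex_hull)
qed

lemma tensor_form_scaleR: "tensor_form m A (c *\<^sub>R x) = c ^ m * tensor_form m A x"
  by (simp add: tensor_form_def prod.distrib sum_distrib_left mult.left_commute)

lemma continuous_tensor_form: "isCont (tensor_form m A) x"
  unfolding tensor_form_def by (intro continuous_intros)

lemma not_copositive_imp_negative_on_simplex:
  fixes A :: "'n::finite list \<Rightarrow> real"
  assumes "\<not> copositive m A" and "m > 0"
  obtains x where "x \<in> standard_simplex" and "tensor_form m A x < 0"
proof -
  obtain y :: "real^'n" where y: "\<And>i. 0 \<le> y $ i" "tensor_form m A y < 0"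
    using assms(1) by (auto simp: copositive_def nonneg_orthant_def not_le)
  define s where "s = (\<Sum>i\<in>UNIV. y $ i)"
  \<comment> \<open>For \<open>m > 0\<close>, homogeneity with factor 0 makes the form vanish at the
    origin.\<close>
  have "y \<noteq> 0"
    using y(2) \<open>m > 0\<close> tensor_form_scaleR [of m A 0 y] by (auto simp: power_0_left)
  then obtain j where "y $ j \<noteq> 0"
    by (auto simp: vec_eq_iff)
  then have "s > 0"
    unfolding s_def using y(1) by (intro sum_pos2 [of _ j]) (auto simp: less_le)
  show thesis
  proof
    show "(1 / s) *\<^sub>R y \<in> standard_simplex"
      using y(1) \<open>s > 0\<close>
      by (simp add: standard_simplex_iff sum_divide_distrib [symmetric] s_def [symmetric])
    show "tensor_form m A ((1 / s) *\<^sub>R y) < 0"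
      using y(2) \<open>s > 0\<close> by (simp add: tensor_form_scaleR mult_pos_neg divide_neg_pos)
  qed
qed

lemma norm_vertex_diff_le_mesh:
  assumes "k \<in> {1..r}"
  shows "norm (u k i - u k j) \<le> mesh r u"
proof -
  have "norm (u k i - u k j) \<le> (MAX (i, j)\<in>UNIV. norm (u k i - u k j))"
    by (rule Max_ge) (auto intro!: image_eqI [of _ _ "(i, j)"])
  also have "\<dots> \<le> mesh r u"
    unfolding mesh_def by (rule Max_ge) (use assms in auto)
  finally show ?thesis .
qed

text \<open>The condition \<open>r \<ge> 1\<close> makes the outer maximum range over a nonempty
  set.\<close>

lemma mesh_less:
  assumes "r \<ge> 1" and "\<And>k i j. k \<in> {1..r} \<Longrightarrow> norm (u k i - u k j) < e"
  shows "mesh r u < e"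
  unfolding mesh_def using assms by (subst Max_less_iff) (auto simp: Max_less_iff)

text \<open>The distance between two points of a simplex is convex in each argument, so it never
  exceeds the length of the longest edge. The bound applies to all vertices of a cell containing
  \<open>x\<close> at once.\<close>

lemma simplicial_partition_vertex_near:
  assumes "simplicial_partition r S u S0" and "x \<in> S0"
  obtains k where "k \<in> {1..r}" and "\<And>i. dist (u k i) x \<le> mesh r u"
proof -
  obtain k where k: "k \<in> {1..r}" "x \<in> S k" and v: "vertices_of_simplex (u k) (S k)"
    using assms by (auto simp: simplicial_partition_def)
  have S: "S k = convex hull (range (u k))"
    using v by (simp add: vertices_of_simplex_def)
  have "dist (u k i) x \<le> mesh r u" for i
  proof -
    have "u k i \<in> S k"
      by (simp add: S hull_inc)
    then obtain a b where "norm (u k i - x) \<le> norm (u k a - u k b)"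
      using simplex_extremal_le_exists [of "range (u k)" "u k i" x] k(2) S by auto
    also have "\<dots> \<le> mesh r u"
      using k(1) by (rule norm_vertex_diff_le_mesh)
    finally show ?thesis
      by (simp add: dist_norm)
  qed
  with k(1) show thesis
    by (rule that)
qed

text \<open>A simplex of dimension \<open>CARD('n) - 1\<close> has exactly \<open>CARD('n)\<close>
  vertices, so the type \<open>'n\<close> can index them bijectively.\<close>

lemma simplex_imp_vertices_of_simplex:
  fixes T :: "(real^'n) set"
  assumes "(int CARD('n) - 1) simplex T"
  obtains v :: "'n \<Rightarrow> real^'n" where "vertices_of_simplex v T"
proof -
  obtain C where C: "finite C" "\<not> affine_dependent C" "card C = CARD('n)" "T = convex hull C"
    using assms by (auto simp: simplex)
  then obtain v :: "'n \<Rightarrow> real^'n" where "bij_betw v UNIV C"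
    using finite_same_card_bij [of "UNIV :: 'n set" C] by auto
  with C show thesis
    by (intro that [of v]) (auto simp: vertices_of_simplex_def bij_betw_def)
qed

text \<open>Two cells meet in a common face, and a proper face misses the relative interior. If the
  relative interiors met, the common face would therefore be all of \<open>S\<close> and all of
  \<open>T\<close>.\<close>

lemma triangulation_disjoint_rel_interior:
  fixes \<T> :: "'a::euclidean_space set set"
  assumes "triangulation \<T>" and "S \<in> \<T>" and "T \<in> \<T>" and "S \<noteq> T"
  shows "rel_interior S \<inter> rel_interior T = {}"
proof (rule ccontr)
  assume ne: "rel_interior S \<inter> rel_interior T \<noteq> {}"
  have f: "S \<inter> T face_of S" "S \<inter> T face_of T"
    using assms unfolding triangulation_def by (blast, metis Int_commute)
  have "S \<inter> T = S"
  proof (rule ccontr)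
    assume "S \<inter> T \<noteq> S"
    with f(1) have "S \<inter> T \<inter> rel_interior S = {}"
      by (rule face_of_disjoint_rel_interior)
    then show False
      using ne rel_interior_subset by blast
  qed
  moreover have "S \<inter> T = T"
  proof (rule ccontr)
    assume "S \<inter> T \<noteq> T"
    with f(2) have "S \<inter> T \<inter> rel_interior T = {}"
      by (rule face_of_disjoint_rel_interior)
    then show False
      using ne rel_interior_subset by blast
  qed
  ultimately show False
    using \<open>S \<noteq> T\<close> by simp
qed

lemma fine_simplicial_partition_exists:
  assumes "e > 0"
  obtains r S and u :: "nat \<Rightarrow> 'n \<Rightarrow> real^'n"
  where "simplicial_partition r S u standard_simplex" and "mesh r u < e"
proof -
  have poly: "polytope (standard_simplex :: (real^'n) set)"
    by (simp add: standard_simplex_eq_convex_hull_Basis polytope_convex_hull)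
  obtain \<T> where tri: "triangulation \<T>"
    and dia: "\<And>T. T \<in> \<T> \<Longrightarrow> diameter T < e"
    and dim: "\<And>T. T \<in> \<T> \<Longrightarrow> aff_dim T = int CARD('n) - 1"
    and Un: "\<Union>\<T> = \<Union>{standard_simplex :: (real^'n) set}"
    \<comment> \<open>The simplex is regarded as a cell complex with a single cell. The subdivision
      keeps the dimension of that cell, so no lower-dimensional pieces occur in
      \<open>\<T>\<close>.\<close>
    by (rule fine_triangular_subdivision_of_cell_complex
          [OF assms, of "{standard_simplex :: (real^'n) set}" "int CARD('n) - 1"])
       (auto simp: poly aff_dim_standard_simplex face_of_refl convex_standard_simplex)
  have "finite \<T>"
    using tri by (simp add: triangulation_def)
  then obtain S where S: "bij_betw S {1..card \<T>} \<T>"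
    using finite_same_card_bij [of "{1..card \<T>}" \<T>] by auto
  \<comment> \<open>A triangulation only provides simplices of some dimension; the affine dimension
    identifies it.\<close>
  have simplex: "(int CARD('n) - 1) simplex T" if "T \<in> \<T>" for T
    using tri dim [OF that] that aff_dim_simplex unfolding triangulation_def by metis
  have "\<forall>k\<in>{1..card \<T>}. \<exists>v :: 'n \<Rightarrow> real^'n. vertices_of_simplex v (S k)"
    using simplex_imp_vertices_of_simplex simplex bij_betwE [OF S] by metis
  then obtain u :: "nat \<Rightarrow> 'n \<Rightarrow> real^'n"
    where u: "\<And>k. k \<in> {1..card \<T>} \<Longrightarrow> vertices_of_simplex (u k) (S k)"
    by metis
  show thesis
  proof
    have "rel_interior (S i) \<inter> rel_interior (S j) = {}"
      if "i \<in> {1..card \<T>}" "j \<in> {1..card \<T>}" "i \<noteq> j" for i j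
    proof (rule triangulation_disjoint_rel_interior [OF tri])
      show "S i \<in> \<T>" "S j \<in> \<T>"
        using that bij_betwE [OF S] by auto
      show "S i \<noteq> S j"
        using that S by (metis bij_betw_imp_inj_on inj_on_contraD)
    qed
    moreover have "standard_simplex = (\<Union>k\<in>{1..card \<T>}. S k)"
      using Un S by (simp add: bij_betw_def)
    ultimately show "simplicial_partition (card \<T>) S u standard_simplex"
      using u by (auto simp: simplicial_partition_def)
    show "mesh (card \<T>) u < e"
    proof (rule mesh_less)
      \<comment> \<open>Any unit vector shows that the simplex is nonempty, hence that there is at
        least one cell; the index is arbitrary.\<close>
      have "axis undefined 1 \<in> (standard_simplex :: (real^'n) set)"
        by (simp add: standard_simplex_eq_convex_hull_Basis hull_inc)
      then have "\<T> \<noteq> {}"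
        using Un by auto
      then show "card \<T> \<ge> 1"
        using \<open>finite \<T>\<close> by (simp add: Suc_le_eq card_gt_0_iff)
      fix k i j
      assume k: "k \<in> {1..card \<T>}"
      have T: "S k \<in> \<T>"
        using k bij_betwE [OF S] by blast
      have "u k i \<in> S k" "u k j \<in> S k"
        using u [OF k] by (auto simp: vertices_of_simplex_def hull_inc)
      \<comment> \<open>The diameter is a supremum of distances; boundedness makes it an upper bound
        for them.\<close>
      moreover have "bounded (S k)"
        using compact_imp_bounded compact_simplex simplex [OF T] by blast
      ultimately have "norm (u k i - u k j) \<le> diameter (S k)"
        using diameter_bounded_bound by (metis dist_norm)
      with dia [OF T] show "norm (u k i - u k j) < e"
        by simp
    qed
  qed
qed

theorem theorem4p4:
  fixes A :: "'n::finite list \<Rightarrow> real" and m :: nat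
  assumes "m \<ge> 3" and "CARD('n) \<ge> 2" and "symmetric_tensor m A"
  shows "\<not> copositive m A \<longleftrightarrow>
    (\<exists>\<epsilon>>0. \<forall>(r::nat) (S :: nat \<Rightarrow> (real^'n) set) (u :: nat \<Rightarrow> 'n \<Rightarrow> real^'n).
        simplicial_partition r S u standard_simplex \<and> mesh r u < \<epsilon> \<longrightarrow>
          (\<exists>k\<in>{1..r}. \<exists>i. tensor_form m A (u k i) < 0))"
  (is "_ \<longleftrightarrow> (\<exists>\<epsilon>>0. ?detects \<epsilon>)")
proof
  assume "\<not> copositive m A"
  then obtain x where x: "x \<in> standard_simplex" "tensor_form m A x < 0"
    using not_copositive_imp_negative_on_simplex \<open>m \<ge> 3\<close> by (metis gr0I not_numeral_le_zero)
  have "\<forall>\<^sub>F y in at x. tensor_form m A y < 0"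
    using continuous_tensor_form x(2) unfolding isCont_def by (rule order_tendstoD(2))
  \<comment> \<open>The filter \<open>at x\<close> leaves out the centre, where \<open>x(2)\<close>
    gives the sign.\<close>
  then obtain \<epsilon> where \<epsilon>: "\<epsilon> > 0" "\<And>y. dist y x < \<epsilon> \<Longrightarrow> tensor_form m A y < 0"
    using x(2) unfolding eventually_at by (metis UNIV_I)
  have "?detects \<epsilon>"
  proof (intro allI impI, elim conjE)
    fix r S and u :: "nat \<Rightarrow> 'n \<Rightarrow> real^'n"
    assume "simplicial_partition r S u standard_simplex" and mesh: "mesh r u < \<epsilon>"
    then obtain k where "k \<in> {1..r}" "\<And>i. dist (u k i) x \<le> mesh r u"
      using simplicial_partition_vertex_near x(1) by metis
    with mesh \<epsilon>(2) show "\<exists>k\<in>{1..r}. \<exists>i. tensor_form m A (u k i) < 0"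
      by (meson le_less_trans)
  qed
  with \<epsilon>(1) show "\<exists>\<epsilon>>0. ?detects \<epsilon>"
    by blast
next
  assume "\<exists>\<epsilon>>0. ?detects \<epsilon>"
  then obtain \<epsilon> where "\<epsilon> > 0" and \<epsilon>: "?detects \<epsilon>"
    by blast
  \<comment> \<open>Existence of a partition this fine rules out that
    \<open>?detects \<epsilon>\<close> holds vacuously.\<close>
  obtain r S and u :: "nat \<Rightarrow> 'n \<Rightarrow> real^'n"
    where part: "simplicial_partition r S u standard_simplex" and "mesh r u < \<epsilon>"
    using fine_simplicial_partition_exists [OF \<open>\<epsilon> > 0\<close>] .
  then obtain k i where k: "k \<in> {1..r}" and neg: "tensor_form m A (u k i) < 0"
    using \<epsilon> by blast
  \<comment> \<open>The vertex lies in its cell, hence in the nonnegative orthant, and so refutes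
    copositivity.\<close>
  have "u k i \<in> S k"
    using part k by (auto simp: simplicial_partition_def vertices_of_simplex_def hull_inc)
  then have "u k i \<in> standard_simplex"
    using part k by (auto simp: simplicial_partition_def)
  with neg show "\<not> copositive m A"
    by (force simp: copositive_def standard_simplex_def)
qed

end
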